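(* Let $c(x,y)=\|x-y\|^2$ and let $\rho$ and $\mu$ be probability measures on $\mathbb{R}^d$. Assume that $\operatorname{Supp}\rho$ is Lipschitz-path connected and that for any $x_0,x_1\in\operatorname{Supp}\rho$ the Lipschitz path $\omega:[0,1]\to\operatorname{Supp}\rho$ from $x_0$ to $x_1$ can be chosen with $$\omega(t)\in\operatorname{int}\left(\operatorname{conv}\operatorname{Supp}\rho\right)\quad\text{for all }t\in[0,1].$$ Then optimisers of the dual problem $$\max\left\{\int\phi\,\mathrm{d}\rho+\int\psi\,\mathrm{d}\mu\ :\ \phi\in L^1(\rho),\ \psi\in L^1(\mu),\ \phi(x)+\psi(y)\le c(x,y)\ \forall x,y\right\}$$ are unique up to a constant: if $(\phi_0,\psi_0)$ and $(\phi_1,\psi_1)$ are optimal, there is $\lambda\in\mathbb{R}$ with $\phi_0=\phi_1+\lambda$ $\rho$-a.e. and $\psi_0=\psi_1-\lambda$ $\mu$-a.e.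
   Context: A set $\Omega\subset\mathbb{R}^d$ is Lipschitz-path connected if for any $x_0,x_1\in\Omega$ there is a finite-length curve (without loss of generality Lipschitz, parametrised with constant speed) $\omega:[0,1]\to\Omega$ with $\omega(0)=x_0$, $\omega(1)=x_1$. $\operatorname{conv}$ is the convex hull and $\operatorname{int}$ the interior in $\mathbb{R}^d$. Standing assumption: there exist $a\in L^1(\rho)$, $b\in L^1(\mu)$ with $c(x,y)\le a(x)+b(y)$ pointwise (here: $\rho$ and $\mu$ have finite second moments), so that the primal and dual problems are finite with equal values and have optimisers. In the dual constraint, $x$ and $y$ range over sets $\mathcal{X},\mathcal{Y}\subset\mathbb{R}^d$ containing $\operatorname{Supp}\rho$ and $\operatorname{Supp}\mu$ respectively. *)

theory Defs
  imports "HOL-Probability.Probability"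
begin

text \<open>The topological support of a Borel measure.\<close>

definition msupport :: "'a::topological_space measure \<Rightarrow> 'a set" where
  "msupport M = {x. \<forall>U. open U \<longrightarrow> x \<in> U \<longrightarrow> emeasure M U > 0}"

text \<open>Finite-length curves are taken in a Lipschitz parametrisation on the unit interval;
  the values of the function outside that interval play no role.\<close>

definition lipschitz_path :: "'a::metric_space set \<Rightarrow> 'a \<Rightarrow> 'a \<Rightarrow> (real \<Rightarrow> 'a) \<Rightarrow> bool" where
  "lipschitz_path S x0 x1 w \<longleftrightarrow>
     (\<exists>L. L-lipschitz_on {0..1} w) \<and> path_image w \<subseteq> S \<and> pathstart w = x0 \<and> pathfinish w = x1"

definition lipschitz_path_connected :: "'a::metric_space set \<Rightarrow> bool" where
  "lipschitz_path_connected S \<longleftrightarrow> (\<forall>x0\<in>S. \<forall>x1\<in>S. \<exists>w. lipschitz_path S x0 x1 w)"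

text \<open>The potentials are total functions, but the pointwise constraint is imposed only on
  \<open>X \<times> Y\<close>. When \<open>X\<close> and \<open>Y\<close> contain the supports of \<open>\<rho>\<close> and \<open>\<mu>\<close> (Borel, on a
  second-countable space), the values outside are irrelevant to the integrals.\<close>

definition dual_feasible ::
  "('a \<Rightarrow> 'b \<Rightarrow> real) \<Rightarrow> 'a set \<Rightarrow> 'b set \<Rightarrow> 'a measure \<Rightarrow> 'b measure \<Rightarrow>
   ('a \<Rightarrow> real) \<Rightarrow> ('b \<Rightarrow> real) \<Rightarrow> bool" where
  "dual_feasible c X Y \<rho> \<mu> \<phi> \<psi> \<longleftrightarrow>
     integrable \<rho> \<phi> \<and> integrable \<mu> \<psi> \<and> (\<forall>x\<in>X. \<forall>y\<in>Y. \<phi> x + \<psi> y \<le> c x y)"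

definition dual_value ::
  "'a measure \<Rightarrow> 'b measure \<Rightarrow> ('a \<Rightarrow> real) \<Rightarrow> ('b \<Rightarrow> real) \<Rightarrow> real" where
  "dual_value \<rho> \<mu> \<phi> \<psi> = (\<integral>x. \<phi> x \<partial>\<rho>) + (\<integral>y. \<psi> y \<partial>\<mu>)"

definition dual_optimal ::
  "('a \<Rightarrow> 'b \<Rightarrow> real) \<Rightarrow> 'a set \<Rightarrow> 'b set \<Rightarrow> 'a measure \<Rightarrow> 'b measure \<Rightarrow>
   ('a \<Rightarrow> real) \<Rightarrow> ('b \<Rightarrow> real) \<Rightarrow> bool" where
  "dual_optimal c X Y \<rho> \<mu> \<phi> \<psi> \<longleftrightarrow>
     dual_feasible c X Y \<rho> \<mu> \<phi> \<psi> \<and>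
     (\<forall>\<phi>' \<psi>'. dual_feasible c X Y \<rho> \<mu> \<phi>' \<psi>' \<longrightarrow> dual_value \<rho> \<mu> \<phi>' \<psi>' \<le> dual_value \<rho> \<mu> \<phi> \<psi>)"

end

theory Submission
  imports Defs
begin

text \<open>
  With \<open>f = ((norm x)\<^sup>2 - \<phi>) / 2\<close> and \<open>g = ((norm y)\<^sup>2 - \<psi>) / 2\<close> the dual constraint reads
  \<open>x \<bullet> y - g y \<le> f x\<close>, and optimality forces \<open>f\<close> to agree almost everywhere with the Legendre
  transform of \<open>g\<close>, a convex function that is finite near the support of \<open>\<rho>\<close>. The midpoint of two
  optimal pairs is again optimal, so on the support the transform of \<open>(g0 + g1) / 2\<close> is the mean of
  the two transforms. A near-maximiser for the midpoint is then a near-maximiser for both, so the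
  two convex functions have common approximate subgradients at every point of the support; no
  optimal transport plan is needed. Along a Lipschitz path the difference of the two
  transforms therefore changes, over a dyadic interval, by no more than second differences of
  Lipschitz functions, and these sum to \<open>o(1)\<close>. This replaces Rademacher's theorem.
  Once \<open>\<phi>0 = \<phi>1\<close> almost everywhere, the pair \<open>(min \<phi>0 \<phi>1, max \<psi>0 \<psi>1)\<close> is feasible, and
  optimality gives \<open>\<psi>0 = \<psi>1\<close> almost everywhere.
\<close>

subsection \<open>Paths with common approximate subgradients\<close>

lemma sum_lessThan_double:
  fixes f :: "nat \<Rightarrow> 'a::comm_monoid_add"
  shows "(\<Sum>j<2*N. f j) = (\<Sum>k<N. f (2*k) + f (2*k+1))"
  by (induction N) (simp_all add: add.assoc)

definition dyadic_second_diff :: "(real \<Rightarrow> 'a::real_normed_vector) \<Rightarrow> nat \<Rightarrow> nat \<Rightarrow> 'a" where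
  "dyadic_second_diff V n k =
     V ((real k + 1) / 2^n) - 2 *\<^sub>R V ((real k + 1/2) / 2^n) + V (real k / 2^n)"

text \<open>The dyadic energies of a Lipschitz curve are bounded, and by the parallelogram law their
  increments are the scaled sums of squared second differences.\<close>

lemma lipschitz_dyadic_second_diff_tendsto:
  fixes V :: "real \<Rightarrow> 'a::real_inner"
  assumes lip: "L-lipschitz_on {0..1} V"
  shows "(\<lambda>n. \<Sum>k<2^n. norm (dyadic_second_diff V n k)) \<longlonglongrightarrow> 0"
proof -
  define d where "d n k = V ((real k + 1) / 2^n) - V (real k / 2^n)" for n k :: nat
  \<comment> \<open>\<open>E n\<close> is the integral over [0,1] of the squared speed of the
    piecewise linear interpolation at the nodes \<open>k / 2^n\<close>.\<close>
  define E where "E n = 2^n * (\<Sum>k<2^n. (norm (d n k))\<^sup>2)" for n :: nat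
  define Q where "Q n = (\<Sum>k<2^n. norm (dyadic_second_diff V n k))" for n
  have d_coarse: "d n k = d (Suc n) (2*k) + d (Suc n) (2*k+1)" for n k
  proof -
    have "(real k + 1) / 2^n = (real (2*k+1) + 1) / 2^Suc n" "real k / 2^n = real (2*k) / 2^Suc n"
      "(real (2*k) + 1) / 2^Suc n = real (2*k+1) / 2^Suc n"
      by (simp_all add: field_simps)
    then show ?thesis
      unfolding d_def by (simp del: power_Suc add: add.commute)
  qed
  have d_diff: "dyadic_second_diff V n k = d (Suc n) (2*k+1) - d (Suc n) (2*k)" for n k
  proof -
    have "(real k + 1) / 2^n = (real (2*k+1) + 1) / 2^Suc n" "real k / 2^n = real (2*k) / 2^Suc n"
      "(real k + 1/2) / 2^n = real (2*k+1) / 2^Suc n"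
      "(real (2*k) + 1) / 2^Suc n = real (2*k+1) / 2^Suc n"
      by (simp_all add: field_simps)
    then show ?thesis
      unfolding d_def dyadic_second_diff_def by (simp del: power_Suc add: scaleR_2 add.commute)
  qed
  have E_step: "E (Suc n) = E n + 2^n * (\<Sum>k<2^n. (norm (dyadic_second_diff V n k))\<^sup>2)" for n
  proof -
    have "2 * ((norm (d (Suc n) (2*k)))\<^sup>2 + (norm (d (Suc n) (2*k+1)))\<^sup>2)
        = (norm (d n k))\<^sup>2 + (norm (dyadic_second_diff V n k))\<^sup>2" for k
      unfolding d_coarse[of n k] d_diff power2_norm_eq_inner
      by (simp add: inner_simps inner_commute algebra_simps)
    then have "(\<Sum>k<2^n. 2 * ((norm (d (Suc n) (2*k)))\<^sup>2 + (norm (d (Suc n) (2*k+1)))\<^sup>2))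
        = (\<Sum>k<2^n. (norm (d n k))\<^sup>2 + (norm (dyadic_second_diff V n k))\<^sup>2)"
      by (intro sum.cong refl)
    then have "2 * (\<Sum>k<2^n. (norm (d (Suc n) (2*k)))\<^sup>2 + (norm (d (Suc n) (2*k+1)))\<^sup>2)
        = (\<Sum>k<2^n. (norm (d n k))\<^sup>2) + (\<Sum>k<2^n. (norm (dyadic_second_diff V n k))\<^sup>2)"
      by (simp only: sum_distrib_left[symmetric] sum.distrib)
    then show ?thesis
      by (simp add: E_def sum_lessThan_double distrib_left[symmetric])
  qed
  have E_mono: "E n \<le> E (Suc n)" for n
    by (simp add: E_step sum_nonneg)
  have E_bound: "E n \<le> L\<^sup>2" for n
  proof -
    have "norm (d n k) \<le> L / 2^n" if "k < 2^n" for k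
    proof -
      have "real k + 1 \<le> 2^n"
        using that by (metis Suc_leI of_nat_Suc of_nat_le_iff of_nat_numeral of_nat_power add.commute)
      then have "real k / 2^n \<in> {0..1}" "(real k + 1) / 2^n \<in> {0..1}"
        using less_imp_le[OF that] by auto
      from lipschitz_onD[OF lip this(2,1)] show ?thesis
        by (simp add: d_def dist_norm diff_divide_distrib[symmetric])
    qed
    then have "E n \<le> 2^n * (\<Sum>k<2^n::nat. (L / 2^n)\<^sup>2)"
      unfolding E_def by (intro mult_left_mono sum_mono power_mono) auto
    also have "\<dots> = L\<^sup>2"
      by (simp add: power2_eq_square)
    finally show ?thesis .
  qed
  have "incseq E"
    using E_mono by (rule incseq_SucI)
  then obtain l where l: "E \<longlonglongrightarrow> l"
    using incseq_convergent[of E "L\<^sup>2"] E_bound by blast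
  \<comment> \<open>Cauchy-Schwarz on \<open>2^n\<close> terms costs a factor \<open>2^n\<close>,
    exactly the weight of the squared second differences in \<open>E_step\<close>.\<close>
  have Q_sq: "(Q n)\<^sup>2 \<le> E (Suc n) - E n" for n
    using sum_squared_le_sum_of_squares[of "\<lambda>k. norm (dyadic_second_diff V n k)" "{..<2^n}"]
    by (simp add: Q_def E_step mult.commute)
  have Q_nonneg: "0 \<le> Q n" for n
    by (simp add: Q_def sum_nonneg)
  have "(\<lambda>n. sqrt (E (Suc n) - E n)) \<longlonglongrightarrow> sqrt (l - l)"
    by (intro tendsto_intros LIMSEQ_Suc l)
  then have "(\<lambda>n. sqrt (E (Suc n) - E n)) \<longlonglongrightarrow> 0"
    by simp
  then have "Q \<longlonglongrightarrow> 0"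
    by (rule Lim_null_comparison[rotated])
       (auto intro!: always_eventually real_le_rsqrt simp: abs_of_nonneg[OF Q_nonneg] Q_sq)
  then show ?thesis
    by (simp add: Q_def[abs_def])
qed

lemma norm_fst_snd_le:
  "norm (fst z) \<le> norm z" "norm (snd z) \<le> norm z"
  by (metis norm_fst_le prod.collapse, metis norm_snd_le prod.collapse)

text \<open>Let \<open>p\<close> be a common approximate subgradient at the midpoint
  \<open>m\<close> of \<open>[a, b]\<close>. It bounds \<open>u a - u m\<close> and
  \<open>u b - u m\<close> from below, and since their sum is a second difference, also from above.
  So \<open>u b - u a\<close> is prescribed by \<open>p\<close> up to second differences of
  \<open>u\<close> and \<open>w\<close>; the same holds for \<open>v\<close> with the same
  \<open>p\<close>, and \<open>p\<close> cancels in \<open>u - v\<close>.\<close>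

lemma common_subgradients_along_path:
  fixes w :: "real \<Rightarrow> 'a::real_inner" and u v :: "real \<Rightarrow> real"
  assumes lip: "L-lipschitz_on {0..1} w"
    and sub: "\<And>t e. t \<in> {0..1} \<Longrightarrow> 0 < e \<Longrightarrow> \<exists>p. norm p \<le> M \<and>
      (\<forall>s\<in>{0..1}. u t + p \<bullet> (w s - w t) - e \<le> u s \<and> v t + p \<bullet> (w s - w t) - e \<le> v s)"
  shows "u 1 - v 1 = u 0 - v 0"
proof -
  have "0 \<le> M"
  proof -
    obtain p :: 'a where "norm p \<le> M"
      using sub[of 0 1] by auto
    then show ?thesis
      using norm_ge_zero order_trans by blast
  qed
  have L0: "0 \<le> L"
    using lip by (rule lipschitz_on_nonneg)
  have one_sided: "u t - u s \<le> M * L * dist s t \<and> v t - v s \<le> M * L * dist s t"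
    if st: "s \<in> {0..1}" "t \<in> {0..1}" for s t
  proof -
    have "u t - u s \<le> M * L * dist s t + e \<and> v t - v s \<le> M * L * dist s t + e" if "0 < e" for e
    proof -
      obtain p where p: "norm p \<le> M" "u t + p \<bullet> (w s - w t) - e \<le> u s"
          "v t + p \<bullet> (w s - w t) - e \<le> v s"
        using sub[OF st(2) \<open>0 < e\<close>] st(1) by blast
      have "- (p \<bullet> (w s - w t)) \<le> norm p * norm (w s - w t)"
        using Cauchy_Schwarz_ineq2[of p "w s - w t"] by linarith
      also have "\<dots> \<le> M * (L * dist s t)"
        using p(1) \<open>0 \<le> M\<close> lipschitz_onD[OF lip st] by (intro mult_mono) (auto simp: dist_norm)
      finally show ?thesis
        using p by (simp add: mult.assoc)
    qed
    then show ?thesis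
      using field_le_epsilon[of "u t - u s" "M * L * dist s t"]
        field_le_epsilon[of "v t - v s" "M * L * dist s t"] by blast
  qed
  have lip_u: "(M * L)-lipschitz_on {0..1} u" and lip_v: "(M * L)-lipschitz_on {0..1} v"
  proof -
    have "dist (u s) (u t) \<le> M * L * dist s t \<and> dist (v s) (v t) \<le> M * L * dist s t"
      if "s \<in> {0..1}" "t \<in> {0..1}" for s t
      using one_sided[of s t] one_sided[of t s] that
      by (simp add: dist_real_def abs_le_iff abs_minus_commute[of s t])
    then show "(M * L)-lipschitz_on {0..1} u" "(M * L)-lipschitz_on {0..1} v"
      using \<open>0 \<le> M\<close> L0 by (simp_all add: lipschitz_on_def)
  qed
  \<comment> \<open>Bundling the three functions into one curve in an inner product space lets a
    single second difference dominate those of \<open>w\<close>, \<open>u\<close> and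
    \<open>v\<close>.\<close>
  define V where "V t = (w t, u t, v t)" for t
  obtain K where lip_V: "K-lipschitz_on {0..1} V"
    using lipschitz_on_Pair[OF lip lipschitz_on_Pair[OF lip_u lip_v]] unfolding V_def[abs_def] by blast
  define h where "h t = u t - v t" for t
  have increment: "\<bar>h ((real k + 1) / 2^n) - h (real k / 2^n)\<bar>
      \<le> (2 + 2 * M) * norm (dyadic_second_diff V n k)" if k: "k < 2^n" for n k
  proof -
    define a where "a = real k / 2^n"
    define m where "m = (real k + 1/2) / 2^n"
    define b where "b = (real k + 1) / 2^n"
    have "real k + 1 \<le> 2^n"
      using k by (metis Suc_leI of_nat_Suc of_nat_le_iff of_nat_numeral of_nat_power add.commute)
    then have I: "a \<in> {0..1}" "m \<in> {0..1}" "b \<in> {0..1}"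
      using less_imp_le[OF k] by (auto simp: a_def m_def b_def field_simps)
    define D where "D = dyadic_second_diff V n k"
    have D_eq: "D = (w b - 2 *\<^sub>R w m + w a, u b - 2 * u m + u a, v b - 2 * v m + v a)"
      by (simp add: D_def dyadic_second_diff_def V_def a_def m_def b_def)
    have Dw: "norm (w b - 2 *\<^sub>R w m + w a) \<le> norm D"
      using norm_fst_snd_le(1)[of D] by (simp add: D_eq)
    have Du: "\<bar>u b - 2 * u m + u a\<bar> \<le> norm D"
      using order_trans[OF norm_fst_snd_le(1)[of "snd D"] norm_fst_snd_le(2)[of D]]
      by (simp add: D_eq)
    have Dv: "\<bar>v b - 2 * v m + v a\<bar> \<le> norm D"
      using order_trans[OF norm_fst_snd_le(2)[of "snd D"] norm_fst_snd_le(2)[of D]]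
      by (simp add: D_eq)
    have "\<bar>h b - h a\<bar> \<le> (2 + 2 * M) * norm D + e" if "0 < e" for e
    proof -
      obtain p where p: "norm p \<le> M"
        "\<And>s. s \<in> {0..1} \<Longrightarrow> u m + p \<bullet> (w s - w m) - e/4 \<le> u s"
        "\<And>s. s \<in> {0..1} \<Longrightarrow> v m + p \<bullet> (w s - w m) - e/4 \<le> v s"
        using sub[OF I(2), of "e/4"] \<open>0 < e\<close> by auto
      have split: "p \<bullet> (w b - 2 *\<^sub>R w m + w a) = p \<bullet> (w b - w m) + p \<bullet> (w a - w m)"
        by (simp add: inner_simps)
      have "\<bar>p \<bullet> (w b - 2 *\<^sub>R w m + w a)\<bar> \<le> norm p * norm (w b - 2 *\<^sub>R w m + w a)"
        by (rule Cauchy_Schwarz_ineq2)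
      also have "\<dots> \<le> M * norm D"
        using p(1) Dw \<open>0 \<le> M\<close> by (intro mult_mono) auto
      finally have "\<bar>p \<bullet> (w b - w m) + p \<bullet> (w a - w m)\<bar> \<le> M * norm D"
        by (simp add: split)
      \<comment> \<open>One \<open>norm D\<close> comes from each of \<open>u\<close> and
        \<open>v\<close>. The term with \<open>M\<close> is doubled because the sum of the two inner
        products enters twice. The four subgradient inequalities cost \<open>e/4\<close>
        each.\<close>
      then have "\<bar>h b - h a\<bar> \<le> norm D + norm D + 2 * (M * norm D) + e"
        using p(2)[OF I(1)] p(2)[OF I(3)] p(3)[OF I(1)] p(3)[OF I(3)] Du Dv
        unfolding h_def by linarith
      then show ?thesis
        by (simp add: algebra_simps)
    qed
    then have "\<bar>h b - h a\<bar> \<le> (2 + 2 * M) * norm D"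
      by (rule field_le_epsilon)
    then show ?thesis
      by (simp add: a_def b_def D_def)
  qed
  have "\<bar>h 1 - h 0\<bar> \<le> (2 + 2 * M) * (\<Sum>k<2^n. norm (dyadic_second_diff V n k))" for n
  proof -
    have "h 1 - h 0 = (\<Sum>k<2^n. h (real (Suc k) / 2^n) - h (real k / 2^n))"
      by (subst sum_lessThan_telescope) simp
    also have "\<bar>\<dots>\<bar> \<le> (\<Sum>k<2^n. (2 + 2 * M) * norm (dyadic_second_diff V n k))"
      using increment by (intro order_trans[OF sum_abs] sum_mono) (auto simp: add.commute)
    finally show ?thesis
      by (simp add: sum_distrib_left)
  qed
  moreover have "(\<lambda>n. (2 + 2 * M) * (\<Sum>k<2^n. norm (dyadic_second_diff V n k))) \<longlonglongrightarrow> (2 + 2 * M) * 0"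
    by (intro tendsto_mult_left lipschitz_dyadic_second_diff_tendsto[OF lip_V])
  ultimately have "\<bar>h 1 - h 0\<bar> \<le> (2 + 2 * M) * 0"
    by (intro LIMSEQ_le_const) auto
  then show ?thesis
    by (simp add: h_def)
qed

subsection \<open>Supports of Borel measures\<close>

lemma open_Compl_msupport: "open (- msupport M)"
proof -
  have "- msupport M = \<Union>{U. open U \<and> emeasure M U = 0}"
    by (auto simp: msupport_def zero_less_iff_neq_zero)
  then show ?thesis
    by auto
qed

lemma closed_msupport: "closed (msupport M)"
  using open_Compl_msupport by (simp add: closed_def)

text \<open>The complement of the support is a union of null open sets; by Lindelof countably many
  of them suffice, so it is null.\<close>

lemma AE_in_msupport:
  fixes M :: "'a::second_countable_topology measure"
  assumes [measurable_cong]: "sets M = sets borel"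
  shows "AE x in M. x \<in> msupport M"
proof -
  obtain F where F: "F \<subseteq> {U. open U \<and> emeasure M U = 0}" "countable F"
      "\<Union>F = \<Union>{U. open U \<and> emeasure M U = 0}"
    using Lindelof[of "{U. open U \<and> emeasure M U = 0}"] by blast
  have eq: "- msupport M = \<Union>F"
    unfolding F(3) by (auto simp: msupport_def zero_less_iff_neq_zero)
  have "U \<in> null_sets M" if "U \<in> F" for U
    using that F(1) assms by (auto simp: null_sets_def)
  then have "\<Union>F \<in> null_sets M"
    using F(2) null_sets_UN'[of F "\<lambda>U. U" M] by simp
  then show ?thesis
    unfolding eq[symmetric] by (rule AE_I') auto
qed

lemma AE_imp_ex_msupport_nbhd:
  assumes M: "sets M = sets borel" and "AE x in M. P x"
    and "x \<in> msupport M" "open W" "x \<in> W"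
  shows "\<exists>z\<in>W. P z"
proof (rule ccontr)
  assume "\<not> (\<exists>z\<in>W. P z)"
  with assms(2) have "AE z in M. z \<notin> W"
    by (auto elim: AE_mp)
  then have "emeasure M W = 0"
    using AE_iff_measurable[of W M "\<lambda>z. z \<notin> W"] assms(4) M sets_eq_imp_space_eq[OF M] by auto
  then show False
    using assms(3-5) by (auto simp: msupport_def)
qed

text \<open>If the values differed at \<open>x\<close>, Hausdorff separation and continuity would
  keep them apart on an open neighbourhood of \<open>x\<close>, which has positive measure.\<close>

lemma AE_eq_imp_eq_on_msupport:
  fixes f g :: "'a::topological_space \<Rightarrow> 'b::t2_space"
  assumes M: "sets M = sets borel" and ae: "AE x in M. f x = g x"
    and "open U" "continuous_on U f" "continuous_on U g" "x \<in> msupport M" "x \<in> U"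
  shows "f x = g x"
proof (rule ccontr)
  assume "f x \<noteq> g x"
  then obtain A B where AB: "open A" "open B" "f x \<in> A" "g x \<in> B" "A \<inter> B = {}"
    by (meson hausdorff)
  let ?W = "(f -` A \<inter> U) \<inter> (g -` B \<inter> U)"
  have "open ?W"
    using assms(4,5) AB(1,2) unfolding continuous_on_open_vimage[OF assms(3)]
    by (intro open_Int[of "_ \<inter> _" "_ \<inter> _"]) simp_all
  then show False
    using AE_imp_ex_msupport_nbhd[OF M ae assms(6), of ?W] AB assms(7) by auto
qed

subsection \<open>Legendre transforms\<close>

text \<open>Off \<open>legendre_dom\<close> the value of \<open>legendre\<close> is an unspecified supremum of an unbounded set.\<close>

definition legendre :: "'a::real_inner set \<Rightarrow> ('a \<Rightarrow> real) \<Rightarrow> 'a \<Rightarrow> real" where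
  "legendre Y g x = (SUP y\<in>Y. x \<bullet> y - g y)"

definition legendre_dom :: "'a::real_inner set \<Rightarrow> ('a \<Rightarrow> real) \<Rightarrow> 'a set" where
  "legendre_dom Y g = {x. bdd_above ((\<lambda>y. x \<bullet> y - g y) ` Y)}"

lemma legendre_upper: "x \<in> legendre_dom Y g \<Longrightarrow> y \<in> Y \<Longrightarrow> x \<bullet> y - g y \<le> legendre Y g x"
  unfolding legendre_def legendre_dom_def by (intro cSUP_upper) auto

lemma legendre_least: "Y \<noteq> {} \<Longrightarrow> (\<And>y. y \<in> Y \<Longrightarrow> x \<bullet> y - g y \<le> b) \<Longrightarrow> legendre Y g x \<le> b"
  unfolding legendre_def by (rule cSUP_least)

lemma legendre_domI: "(\<And>y. y \<in> Y \<Longrightarrow> x \<bullet> y - g y \<le> b) \<Longrightarrow> x \<in> legendre_dom Y g"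
  unfolding legendre_dom_def mem_Collect_eq by (rule bdd_aboveI2)

lemma legendre_convex_comb:
  assumes "Y \<noteq> {}" "x \<in> legendre_dom Y g" "z \<in> legendre_dom Y g" "0 \<le> a" "0 \<le> b" "a + b = 1"
  shows "a *\<^sub>R x + b *\<^sub>R z \<in> legendre_dom Y g"
    and "legendre Y g (a *\<^sub>R x + b *\<^sub>R z) \<le> a * legendre Y g x + b * legendre Y g z"
proof -
  have *: "(a *\<^sub>R x + b *\<^sub>R z) \<bullet> y - g y \<le> a * legendre Y g x + b * legendre Y g z"
    if "y \<in> Y" for y
  proof -
    have "(a *\<^sub>R x + b *\<^sub>R z) \<bullet> y - g y = a * (x \<bullet> y - g y) + b * (z \<bullet> y - g y)"
    proof -
      have b: "b = 1 - a"
        using \<open>a + b = 1\<close> by simp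
      show ?thesis
        unfolding b by (simp add: inner_add_left algebra_simps)
    qed
    also have "\<dots> \<le> a * legendre Y g x + b * legendre Y g z"
      using assms that by (intro add_mono mult_left_mono legendre_upper) auto
    finally show ?thesis .
  qed
  show "a *\<^sub>R x + b *\<^sub>R z \<in> legendre_dom Y g"
    using * by (rule legendre_domI)
  show "legendre Y g (a *\<^sub>R x + b *\<^sub>R z) \<le> a * legendre Y g x + b * legendre Y g z"
    using \<open>Y \<noteq> {}\<close> * by (rule legendre_least)
qed

lemma convex_legendre_dom: "Y \<noteq> {} \<Longrightarrow> convex (legendre_dom Y g)"
  by (intro convexI legendre_convex_comb)

lemma continuous_on_legendre:
  fixes Y :: "'a::euclidean_space set"
  assumes "Y \<noteq> {}"
  shows "continuous_on (interior (legendre_dom Y g)) (legendre Y g)"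
proof (rule convex_on_continuous)
  have "convex_on (legendre_dom Y g) (legendre Y g)"
    using assms legendre_convex_comb(2)[OF assms] convex_legendre_dom[OF assms]
    by (auto intro!: convex_onI simp: convex_on_def)
  then show "convex_on (interior (legendre_dom Y g)) (legendre Y g)"
    using interior_subset convex_interior[OF convex_legendre_dom[OF assms]]
    by (rule convex_on_subset)
qed simp

text \<open>The supremum may be uncountable, so measurability is read off from sublevel sets: on
  \<open>S\<close> these are intersections of \<open>S\<close> with closed half-spaces (or the whole
  space or the empty set when \<open>y = 0\<close>). Setting the function to 0 off \<open>S\<close>
  avoids the unspecified values outside the domain.\<close>

lemma legendre_measurable:
  fixes Y :: "'a::euclidean_space set"
  assumes "Y \<noteq> {}" "closed S" "S \<subseteq> legendre_dom Y g"
  shows "(\<lambda>x. if x \<in> S then legendre Y g x else 0) \<in> borel_measurable borel"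
  unfolding borel_measurable_iff_le
proof
  fix a
  have "closed (S \<inter> (\<Inter>y\<in>Y. {x. x \<bullet> y - g y \<le> a}))"
    using assms(2) by (intro closed_Int closed_INT ballI closed_Collect_le continuous_intros)
  moreover have "legendre Y g x \<le> a \<longleftrightarrow> (\<forall>y\<in>Y. x \<bullet> y - g y \<le> a)" if "x \<in> S" for x
    using legendre_least[OF assms(1), of x g a] legendre_upper[of x Y g] assms(3) that
    by (meson order_trans subsetD)
  then have "{x \<in> space borel. (if x \<in> S then legendre Y g x else 0) \<le> a}
      = (S \<inter> (\<Inter>y\<in>Y. {x. x \<bullet> y - g y \<le> a})) \<union> (if 0 \<le> a then - S else {})"
    by auto
  ultimately show "{x \<in> space borel. (if x \<in> S then legendre Y g x else 0) \<le> a} \<in> sets borel"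
    using assms(2) by (auto intro!: sets.Un)
qed

section \<open>Near-maximisers as common approximate subgradients\<close>

text \<open>The objective for the midpoint is the mean of two objectives, each at most its own
  transform. If at every \<open>y\<close> one of them fell short by more than \<open>e\<close>, the
  transform of the midpoint would fall short of the mean by at least \<open>e / 2\<close>.\<close>

lemma legendre_common_near_maximiser:
  assumes "Y \<noteq> {}" "x \<in> legendre_dom Y g" "x \<in> legendre_dom Y h" "0 < e"
    and mid: "legendre Y (\<lambda>y. (g y + h y) / 2) x = (legendre Y g x + legendre Y h x) / 2"
  shows "\<exists>y\<in>Y. legendre Y g x - e \<le> x \<bullet> y - g y \<and> legendre Y h x - e \<le> x \<bullet> y - h y"
proof (rule ccontr)
  assume neg: "\<not> ?thesis"
  have "legendre Y (\<lambda>y. (g y + h y) / 2) x \<le> (legendre Y g x + legendre Y h x) / 2 - e / 2"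
  proof (rule legendre_least[OF \<open>Y \<noteq> {}\<close>])
    fix y assume "y \<in> Y"
    then show "x \<bullet> y - (g y + h y) / 2 \<le> (legendre Y g x + legendre Y h x) / 2 - e / 2"
      using neg legendre_upper[OF assms(2) \<open>y \<in> Y\<close>] legendre_upper[OF assms(3) \<open>y \<in> Y\<close>]
      by (fastforce simp: not_le field_simps)
  qed
  then show False
    using mid \<open>0 < e\<close> by linarith
qed

text \<open>Moving \<open>x\<close> a distance \<open>r\<close> in the direction of \<open>y\<close>
  raises \<open>x \<bullet> y\<close> by \<open>r * norm y\<close>, while the transform stays
  bounded on a compact neighbourhood of \<open>K\<close>; hence a near-maximiser cannot be
  long.\<close>

lemma near_maximisers_bounded:
  fixes Y :: "'a::euclidean_space set"
  assumes "Y \<noteq> {}" "compact K" "K \<subseteq> interior (legendre_dom Y g)"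
  shows "\<exists>M. \<forall>x\<in>K. \<forall>y\<in>Y. legendre Y g x - 1 \<le> x \<bullet> y - g y \<longrightarrow> norm y \<le> M"
proof -
  obtain r where r: "0 < r" "(\<Union>x\<in>K. cball x r) \<subseteq> interior (legendre_dom Y g)"
    using compact_subset_open_imp_cball_epsilon_subset[OF assms(2) open_interior assms(3)] .
  define N where "N = (\<Union>x\<in>K. \<Union>z\<in>cball 0 r. {x + z})"
  have "compact N"
    unfolding N_def using compact_sums'[OF assms(2) compact_cball] by simp
  have N: "N \<subseteq> interior (legendre_dom Y g)"
    using r(2) by (force simp: N_def dist_norm)
  have "compact (legendre Y g ` N)"
    using \<open>compact N\<close> continuous_on_subset[OF continuous_on_legendre[OF assms(1)] N]
    by (rule compact_continuous_image[rotated])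
  then obtain B where B: "\<And>z. z \<in> N \<Longrightarrow> \<bar>legendre Y g z\<bar> \<le> B"
    using compact_imp_bounded[of "legendre Y g ` N"] by (auto simp: bounded_iff)
  have "norm y \<le> (2 * B + 1) / r"
    if x: "x \<in> K" and y: "y \<in> Y" "legendre Y g x - 1 \<le> x \<bullet> y - g y" for x y
  \<comment> \<open>The direction \<open>y / norm y\<close> needs \<open>y\<close> nonzero; for
    \<open>y = 0\<close> the bound only has to be nonnegative, and \<open>B\<close> is, since it
    bounds an absolute value at \<open>x\<close>.\<close>
  proof (cases "y = 0")
    case True
    have "x \<in> N"
      using x r(1) by (force simp: N_def)
    then show ?thesis
      using True B[of x] r(1) by simp
  next
    case False
    define z where "z = x + (r / norm y) *\<^sub>R y"
    have zN: "z \<in> N" and xN: "x \<in> N"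
      using x r(1) False by (force simp: N_def z_def)+
    have "z \<bullet> y - g y \<le> legendre Y g z"
      using zN N interior_subset y(1) by (intro legendre_upper) auto
    moreover have "z \<bullet> y = x \<bullet> y + r * norm y"
      using False by (simp add: z_def inner_simps flip: power2_norm_eq_inner)
        (simp add: power2_eq_square)
    \<comment> \<open>Each of the transforms at \<open>z\<close> and \<open>x\<close> contributes
      \<open>B\<close>, and the slack of the near-maximiser contributes 1.\<close>
    ultimately have "r * norm y \<le> 2 * B + 1"
      using y(2) B[OF zN] B[OF xN] by linarith
    then show ?thesis
      using r(1) by (simp add: field_simps)
  qed
  then show ?thesis
    by blast
qed

text \<open>A common near-maximiser \<open>y\<close> at \<open>w t\<close> is a common approximate
  subgradient there, because it is also a competitor in the suprema at \<open>w s\<close>.\<close>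

lemma legendre_diff_constant_along_path:
  fixes Y :: "'a::euclidean_space set" and w :: "real \<Rightarrow> 'a"
  assumes "Y \<noteq> {}" and lip: "L-lipschitz_on {0..1} w"
    and dom: "w ` {0..1} \<subseteq> interior (legendre_dom Y g)" "w ` {0..1} \<subseteq> interior (legendre_dom Y h)"
    and mid: "\<And>t. t \<in> {0..1} \<Longrightarrow> legendre Y (\<lambda>y. (g y + h y) / 2) (w t)
      = (legendre Y g (w t) + legendre Y h (w t)) / 2"
  shows "legendre Y g (w 1) - legendre Y h (w 1) = legendre Y g (w 0) - legendre Y h (w 0)"
proof -
  have "compact (w ` {0..1})"
    by (intro compact_continuous_image lipschitz_on_continuous_on[OF lip] compact_Icc)
  then obtain M where M: "\<And>x y. x \<in> w ` {0..1} \<Longrightarrow> y \<in> Y \<Longrightarrow>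
      legendre Y g x - 1 \<le> x \<bullet> y - g y \<Longrightarrow> norm y \<le> M"
    using near_maximisers_bounded[OF assms(1) _ dom(1)] by blast
  have in_dom: "w s \<in> legendre_dom Y g" "w s \<in> legendre_dom Y h" if "s \<in> {0..1}" for s
    using dom that interior_subset by blast+
  show ?thesis
  proof (rule common_subgradients_along_path[OF lip])
    fix t e :: real
    assume t: "t \<in> {0..1}" and "0 < e"
    \<comment> \<open>Capping the tolerance at 1 brings \<open>y\<close> within reach of the bound
      \<open>M\<close>, which was obtained for slack 1.\<close>
    then have "0 < min 1 e"
      by simp
    from legendre_common_near_maximiser[OF assms(1) in_dom[OF t] this mid[OF t]]
    obtain y where y: "y \<in> Y" "legendre Y g (w t) - min 1 e \<le> w t \<bullet> y - g y"
        "legendre Y h (w t) - min 1 e \<le> w t \<bullet> y - h y"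
      by blast
    have "norm y \<le> M"
      using M[of "w t" y] t y by auto
    moreover have "legendre Y g (w t) + y \<bullet> (w s - w t) - e \<le> legendre Y g (w s) \<and>
        legendre Y h (w t) + y \<bullet> (w s - w t) - e \<le> legendre Y h (w s)" if "s \<in> {0..1}" for s
      using legendre_upper[OF in_dom(1)[OF that] y(1)] legendre_upper[OF in_dom(2)[OF that] y(1)] y(2,3)
      by (auto simp: inner_diff_right inner_commute[of y])
    ultimately show "\<exists>p. norm p \<le> M \<and> (\<forall>s\<in>{0..1}.
        legendre Y g (w t) + p \<bullet> (w s - w t) - e \<le> legendre Y g (w s) \<and>
        legendre Y h (w t) + p \<bullet> (w s - w t) - e \<le> legendre Y h (w s))"
      by blast
  qed
qed

subsection \<open>Optimal dual potentials\<close>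

definition quad_dual :: "('a::real_inner \<Rightarrow> real) \<Rightarrow> 'a \<Rightarrow> real" where
  "quad_dual \<psi> y = ((norm y)\<^sup>2 - \<psi> y) / 2"

lemma quad_cost_inner:
  "\<phi> x + \<psi> y \<le> (norm (x - y))\<^sup>2 \<longleftrightarrow> x \<bullet> y - quad_dual \<psi> y \<le> quad_dual \<phi> x"
  unfolding quad_dual_def power2_norm_eq_inner
  by (simp add: inner_diff_left inner_diff_right inner_commute[of y x] field_simps) linarith

lemma AE_eq_of_integral_le:
  fixes f g :: "'a \<Rightarrow> real"
  assumes f: "integrable M f" and g: "integrable M g" and le: "AE x in M. f x \<le> g x"
    and int: "integral\<^sup>L M g \<le> integral\<^sup>L M f"
  shows "AE x in M. f x = g x"
proof -
  have nonneg: "AE x in M. 0 \<le> g x - f x"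
    using le by simp
  have "(\<integral>x. g x - f x \<partial>M) = 0"
    using integral_nonneg_AE[OF nonneg] int f g by simp
  then have "AE x in M. g x - f x = 0"
    using integral_nonneg_eq_0_iff_AE[OF Bochner_Integration.integrable_diff[OF g f] nonneg] by blast
  then show ?thesis
    by eventually_elim simp
qed

text \<open>Replacing \<open>\<phi>\<close> on the support by the largest function compatible with
  \<open>\<psi>\<close> keeps the pair feasible and does not decrease \<open>\<phi>\<close>.
  Optimality then leaves no gain in the integral, so the two agree almost everywhere.\<close>

lemma optimal_potential_eq_legendre:
  fixes \<rho> \<mu> :: "'a::euclidean_space measure"
  assumes sets: "sets \<rho> = sets borel" and fin: "finite_measure \<rho>"
    and moment: "integrable \<rho> (\<lambda>x. (norm x)\<^sup>2)"
    and supp: "msupport \<rho> \<subseteq> X" and "Y \<noteq> {}"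
    and opt: "dual_optimal (\<lambda>x y. (norm (x - y))\<^sup>2) X Y \<rho> \<mu> \<phi> \<psi>"
  shows "AE x in \<rho>. quad_dual \<phi> x = legendre Y (quad_dual \<psi>) x"
proof -
  interpret finite_measure \<rho> by (rule fin)
  define S where "S = msupport \<rho>"
  define f where "f = legendre Y (quad_dual \<psi>)"
  \<comment> \<open>The change is made only on \<open>S\<close>, which is closed and hence Borel,
    whereas \<open>X\<close> is an arbitrary set.\<close>
  define \<phi>' where "\<phi>' x = (if x \<in> S then (norm x)\<^sup>2 - 2 * f x else \<phi> x)" for x
  note [measurable_cong] = sets
  have feas: "integrable \<rho> \<phi>" "integrable \<mu> \<psi>"
    "\<And>x y. x \<in> X \<Longrightarrow> y \<in> Y \<Longrightarrow> x \<bullet> y - quad_dual \<psi> y \<le> quad_dual \<phi> x"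
    using opt unfolding dual_optimal_def dual_feasible_def quad_cost_inner by auto
  have [measurable]: "\<phi> \<in> borel_measurable borel"
    using feas(1) by (subst measurable_cong_sets[OF sets[symmetric] refl]) auto
  have S: "closed S" "S \<subseteq> legendre_dom Y (quad_dual \<psi>)"
  proof -
    show "closed S"
      by (simp add: S_def closed_msupport)
    have "x \<in> legendre_dom Y (quad_dual \<psi>)" if "x \<in> X" for x
      using feas(3)[OF that] by (rule legendre_domI)
    then show "S \<subseteq> legendre_dom Y (quad_dual \<psi>)"
      using supp by (auto simp: S_def)
  qed
  have [measurable]: "S \<in> sets borel"
    using S(1) by simp
  have ge: "\<phi> x \<le> \<phi>' x" if "x \<in> X" for x
    using legendre_least[OF \<open>Y \<noteq> {}\<close>, of x "quad_dual \<psi>" "quad_dual \<phi> x"] feas(3)[OF that]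
    by (auto simp: \<phi>'_def f_def quad_dual_def[of \<phi>] field_simps)
  have constr: "\<phi>' x + \<psi> y \<le> (norm (x - y))\<^sup>2" if "x \<in> X" "y \<in> Y" for x y
    unfolding quad_cost_inner using legendre_upper[of x Y "quad_dual \<psi>" y] S(2) feas(3) that
    by (auto simp: \<phi>'_def f_def quad_dual_def[of \<phi>'] quad_dual_def[of \<phi>])
  obtain y0 where "y0 \<in> Y"
    using \<open>Y \<noteq> {}\<close> by blast
  have "integrable \<rho> \<phi>'"
  proof (rule Bochner_Integration.integrable_bound)
    show "integrable \<rho> (\<lambda>x. \<bar>\<phi> x\<bar> + 2 * (norm x)\<^sup>2 + (2 * (norm y0)\<^sup>2 + \<bar>\<psi> y0\<bar>))"
      using feas(1) moment by (intro Bochner_Integration.integrable_add integrable_abs) auto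
    \<comment> \<open>The inner conditional exhibits the zero extension of \<open>f\<close>, whose
      measurability is known.\<close>
    have "(\<lambda>x. if x \<in> S then (norm x)\<^sup>2 - 2 * (if x \<in> S then f x else 0) else \<phi> x)
        \<in> borel_measurable borel"
      using legendre_measurable[OF \<open>Y \<noteq> {}\<close> S] unfolding f_def[symmetric] by measurable
    also have "(\<lambda>x. if x \<in> S then (norm x)\<^sup>2 - 2 * (if x \<in> S then f x else 0) else \<phi> x) = \<phi>'"
      by (auto simp: \<phi>'_def)
    finally show "\<phi>' \<in> borel_measurable \<rho>"
      by measurable
    \<comment> \<open>On \<open>S\<close>, \<open>\<phi>\<close> bounds \<open>\<phi>'\<close> from
      below; the constraint against the fixed point \<open>y0\<close>, with the parallelogram law,
      bounds it from above.\<close>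
    have "\<bar>\<phi>' x\<bar> \<le> \<bar>\<phi> x\<bar> + 2 * (norm x)\<^sup>2 + (2 * (norm y0)\<^sup>2 + \<bar>\<psi> y0\<bar>)" for x
    proof (cases "x \<in> S")
      case True
      then have "x \<in> X"
        using supp by (auto simp: S_def)
      have "(norm (x - y0))\<^sup>2 + (norm (x + y0))\<^sup>2 = 2 * (norm x)\<^sup>2 + 2 * (norm y0)\<^sup>2"
        by (simp add: power2_norm_eq_inner inner_simps inner_commute)
      then have "(norm (x - y0))\<^sup>2 \<le> 2 * (norm x)\<^sup>2 + 2 * (norm y0)\<^sup>2"
        by (metis le_add_same_cancel1 zero_le_power2)
      then show ?thesis
        using ge[OF \<open>x \<in> X\<close>] constr[OF \<open>x \<in> X\<close> \<open>y0 \<in> Y\<close>]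
          zero_le_power2[of "norm x"] zero_le_power2[of "norm y0"] by linarith
    qed (simp add: \<phi>'_def)
    then show "AE x in \<rho>. norm (\<phi>' x) \<le> norm (\<bar>\<phi> x\<bar> + 2 * (norm x)\<^sup>2 + (2 * (norm y0)\<^sup>2 + \<bar>\<psi> y0\<bar>))"
      by (intro always_eventually allI) (metis abs_ge_self order_trans real_norm_def)
  qed
  moreover from this have "dual_feasible (\<lambda>x y. (norm (x - y))\<^sup>2) X Y \<rho> \<mu> \<phi>' \<psi>"
    using constr feas(2) unfolding dual_feasible_def by blast
  then have "dual_value \<rho> \<mu> \<phi>' \<psi> \<le> dual_value \<rho> \<mu> \<phi> \<psi>"
    using opt unfolding dual_optimal_def by blast
  then have "(\<integral>x. \<phi>' x \<partial>\<rho>) \<le> (\<integral>x. \<phi> x \<partial>\<rho>)"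
    by (simp add: dual_value_def)
  ultimately have "AE x in \<rho>. \<phi> x = \<phi>' x"
  proof (intro AE_eq_of_integral_le feas(1))
    show "AE x in \<rho>. \<phi> x \<le> \<phi>' x"
      using AE_in_msupport[OF sets] by eventually_elim (use ge supp in blast)
  qed auto
  then show ?thesis
    using AE_in_msupport[OF sets]
  proof eventually_elim
    case (elim x)
    then have "\<phi> x = (norm x)\<^sup>2 - 2 * f x"
      by (simp only: \<phi>'_def S_def if_True)
    then show ?case
      by (simp add: quad_dual_def[of \<phi>] f_def)
  qed
qed

section \<open>Operations on optimal pairs\<close>

lemma dual_optimal_value_eq:
  "dual_optimal c X Y \<rho> \<mu> \<phi>0 \<psi>0 \<Longrightarrow> dual_optimal c X Y \<rho> \<mu> \<phi>1 \<psi>1 \<Longrightarrow>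
    dual_value \<rho> \<mu> \<phi>0 \<psi>0 = dual_value \<rho> \<mu> \<phi>1 \<psi>1"
  by (simp add: dual_optimal_def order_antisym)

lemma dual_optimal_midpoint:
  assumes "dual_optimal c X Y \<rho> \<mu> \<phi>0 \<psi>0" "dual_optimal c X Y \<rho> \<mu> \<phi>1 \<psi>1"
  shows "dual_optimal c X Y \<rho> \<mu> (\<lambda>x. (\<phi>0 x + \<phi>1 x) / 2) (\<lambda>y. (\<psi>0 y + \<psi>1 y) / 2)"
proof -
  have feas: "dual_feasible c X Y \<rho> \<mu> \<phi>0 \<psi>0" "dual_feasible c X Y \<rho> \<mu> \<phi>1 \<psi>1"
    using assms by (auto simp: dual_optimal_def)
  have "dual_value \<rho> \<mu> (\<lambda>x. (\<phi>0 x + \<phi>1 x) / 2) (\<lambda>y. (\<psi>0 y + \<psi>1 y) / 2)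
      = (dual_value \<rho> \<mu> \<phi>0 \<psi>0 + dual_value \<rho> \<mu> \<phi>1 \<psi>1) / 2"
    using feas by (simp add: dual_feasible_def dual_value_def add_divide_distrib)
  also have "\<dots> = dual_value \<rho> \<mu> \<phi>0 \<psi>0"
    using dual_optimal_value_eq[OF assms] by simp
  finally show ?thesis
    using assms(1) feas by (fastforce simp: dual_optimal_def dual_feasible_def field_simps)
qed

lemma dual_optimal_shift:
  assumes "prob_space \<rho>" "prob_space \<mu>" "dual_optimal c X Y \<rho> \<mu> \<phi> \<psi>"
  shows "dual_optimal c X Y \<rho> \<mu> (\<lambda>x. \<phi> x + l) (\<lambda>y. \<psi> y - l)"
proof -
  interpret r: prob_space \<rho> by fact
  interpret m: prob_space \<mu> by fact
  have feas: "dual_feasible c X Y \<rho> \<mu> \<phi> \<psi>"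
    using assms(3) by (simp add: dual_optimal_def)
  then have "dual_value \<rho> \<mu> (\<lambda>x. \<phi> x + l) (\<lambda>y. \<psi> y - l) = dual_value \<rho> \<mu> \<phi> \<psi>"
    by (simp add: dual_feasible_def dual_value_def r.prob_space m.prob_space)
  then show ?thesis
    using assms(3) feas by (auto simp: dual_optimal_def dual_feasible_def)
qed

lemma dual_optimal_snd_AE_eq:
  assumes opt: "dual_optimal c X Y \<rho> \<mu> \<phi>0 \<psi>0" "dual_optimal c X Y \<rho> \<mu> \<phi>1 \<psi>1"
    and eq: "AE x in \<rho>. \<phi>0 x = \<phi>1 x"
  shows "AE y in \<mu>. \<psi>0 y = \<psi>1 y"
proof -
  have int: "integrable \<rho> \<phi>0" "integrable \<rho> \<phi>1" "integrable \<mu> \<psi>0" "integrable \<mu> \<psi>1"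
    using opt by (auto simp: dual_optimal_def dual_feasible_def)
  let ?\<phi> = "\<lambda>x. min (\<phi>0 x) (\<phi>1 x)" and ?\<psi> = "\<lambda>y. max (\<psi>0 y) (\<psi>1 y)"
  have feas: "dual_feasible c X Y \<rho> \<mu> ?\<phi> ?\<psi>"
    unfolding dual_feasible_def
  proof (intro conjI ballI integrable_min integrable_max int)
    fix x y assume "x \<in> X" "y \<in> Y"
    \<comment> \<open>Whichever of \<open>\<psi>0 y\<close> and \<open>\<psi>1 y\<close> is the
      larger, its own partner at \<open>x\<close> is at least the minimum.\<close>
    then have "\<phi>0 x + \<psi>0 y \<le> c x y" "\<phi>1 x + \<psi>1 y \<le> c x y"
      using opt by (auto simp: dual_optimal_def dual_feasible_def)
    then show "?\<phi> x + ?\<psi> y \<le> c x y"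
      by linarith
  qed
  have min_eq: "(\<integral>x. ?\<phi> x \<partial>\<rho>) = (\<integral>x. \<phi>0 x \<partial>\<rho>)" "(\<integral>x. ?\<phi> x \<partial>\<rho>) = (\<integral>x. \<phi>1 x \<partial>\<rho>)"
    using eq int by (auto intro!: integral_cong_AE elim!: AE_mp)
  have le: "(\<integral>y. ?\<psi> y \<partial>\<mu>) \<le> (\<integral>y. \<psi>0 y \<partial>\<mu>)" "(\<integral>y. ?\<psi> y \<partial>\<mu>) \<le> (\<integral>y. \<psi>1 y \<partial>\<mu>)"
  proof -
    have "dual_value \<rho> \<mu> ?\<phi> ?\<psi> \<le> dual_value \<rho> \<mu> \<phi>0 \<psi>0" "dual_value \<rho> \<mu> ?\<phi> ?\<psi> \<le> dual_value \<rho> \<mu> \<phi>1 \<psi>1"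
      using opt feas unfolding dual_optimal_def by blast+
    then show "(\<integral>y. ?\<psi> y \<partial>\<mu>) \<le> (\<integral>y. \<psi>0 y \<partial>\<mu>)" "(\<integral>y. ?\<psi> y \<partial>\<mu>) \<le> (\<integral>y. \<psi>1 y \<partial>\<mu>)"
      using min_eq by (simp_all add: dual_value_def)
  qed
  have "AE y in \<mu>. \<psi>0 y = ?\<psi> y"
    using le(1) int by (intro AE_eq_of_integral_le) auto
  moreover have "AE y in \<mu>. \<psi>1 y = ?\<psi> y"
    using le(2) int by (intro AE_eq_of_integral_le) auto
  ultimately show ?thesis
    by eventually_elim simp
qed

section \<open>Uniqueness of optimal potentials\<close>

theorem theorem5p10:
  fixes \<rho> \<mu> :: "(real ^ 'd) measure"
    and X Y :: "(real ^ 'd) set"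
    and c :: "real ^ 'd \<Rightarrow> real ^ 'd \<Rightarrow> real"
    and \<phi>0 \<psi>0 \<phi>1 \<psi>1 :: "real ^ 'd \<Rightarrow> real"
  assumes c_def: "\<And>x y. c x y = (norm (x - y))\<^sup>2"
    and prob: "prob_space \<rho>" "prob_space \<mu>"
    and borel: "sets \<rho> = sets borel" "sets \<mu> = sets borel"
    and second_moments: "integrable \<rho> (\<lambda>x. (norm x)\<^sup>2)" "integrable \<mu> (\<lambda>y. (norm y)\<^sup>2)"
    and supports: "msupport \<rho> \<subseteq> X" "msupport \<mu> \<subseteq> Y"
    and connected: "lipschitz_path_connected (msupport \<rho>)"
    and interior_paths: "\<And>x0 x1. x0 \<in> msupport \<rho> \<Longrightarrow> x1 \<in> msupport \<rho> \<Longrightarrow>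
      \<exists>w. lipschitz_path (msupport \<rho>) x0 x1 w \<and>
          (\<forall>t\<in>{0..1}. w t \<in> interior (convex hull (msupport \<rho>)))"
    and optimal: "dual_optimal c X Y \<rho> \<mu> \<phi>0 \<psi>0" "dual_optimal c X Y \<rho> \<mu> \<phi>1 \<psi>1"
  shows "\<exists>l::real. (AE x in \<rho>. \<phi>0 x = \<phi>1 x + l) \<and> (AE y in \<mu>. \<psi>0 y = \<psi>1 y - l)"
proof -
  interpret r: prob_space \<rho> by fact
  interpret m: prob_space \<mu> by fact
  define S where "S = msupport \<rho>"
  define U where "U = interior (convex hull S)"
  have c: "c = (\<lambda>x y. (norm (x - y))\<^sup>2)"
    using c_def by blast
  have ex_supp: "msupport M \<noteq> {}" if "prob_space M" "sets M = sets borel" for M :: "(real^'d) measure"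
    using AE_in_msupport[OF that(2)] prob_space.AE_False[OF that(1)] by auto
  have "Y \<noteq> {}"
    using ex_supp[OF prob(2) borel(2)] supports(2) by blast
  obtain x0 where x0: "x0 \<in> S"
    using ex_supp[OF prob(1) borel(1)] by (auto simp: S_def)
  define g0 where "g0 = quad_dual \<psi>0"
  define g1 where "g1 = quad_dual \<psi>1"
  define gm where "gm = (\<lambda>y. (g0 y + g1 y) / 2)"
  have gm: "gm = quad_dual (\<lambda>y. (\<psi>0 y + \<psi>1 y) / 2)"
    by (auto simp: gm_def g0_def g1_def quad_dual_def field_simps)
  have AE_legendre: "AE x in \<rho>. quad_dual \<phi> x = legendre Y (quad_dual \<psi>) x"
    and U_dom: "U \<subseteq> interior (legendre_dom Y (quad_dual \<psi>))"
    if "dual_optimal c X Y \<rho> \<mu> \<phi> \<psi>" for \<phi> \<psi>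
  proof -
    show "AE x in \<rho>. quad_dual \<phi> x = legendre Y (quad_dual \<psi>) x"
      using optimal_potential_eq_legendre[OF borel(1) r.finite_measure_axioms second_moments(1)
          supports(1) \<open>Y \<noteq> {}\<close>] that unfolding c by blast
    have "x \<bullet> y - quad_dual \<psi> y \<le> quad_dual \<phi> x" if "x \<in> X" "y \<in> Y" for x y
      using \<open>dual_optimal c X Y \<rho> \<mu> \<phi> \<psi>\<close> that
      unfolding c dual_optimal_def dual_feasible_def quad_cost_inner by blast
    then have "S \<subseteq> legendre_dom Y (quad_dual \<psi>)"
      using supports(1) unfolding S_def by (blast intro: legendre_domI)
    \<comment> \<open>The domain of the transform is convex, so with \<open>S\<close> it contains
      the convex hull, and interiors preserve the inclusion.\<close>
    then show "U \<subseteq> interior (legendre_dom Y (quad_dual \<psi>))"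
      unfolding U_def by (intro interior_mono hull_minimal convex_legendre_dom \<open>Y \<noteq> {}\<close>)
  qed
  note mid_opt = dual_optimal_midpoint[OF optimal]
  note AE_each = AE_legendre[OF optimal(1), folded g0_def] AE_legendre[OF optimal(2), folded g1_def]
    AE_legendre[OF mid_opt, folded gm]
  note dom_each = U_dom[OF optimal(1), folded g0_def] U_dom[OF optimal(2), folded g1_def]
    U_dom[OF mid_opt, folded gm]
  have AE_mid: "AE x in \<rho>. legendre Y gm x = (legendre Y g0 x + legendre Y g1 x) / 2"
    using AE_each by eventually_elim (simp add: quad_dual_def field_simps)
  have "open U"
    by (simp add: U_def)
  \<comment> \<open>The path hypothesis with both endpoints equal to \<open>x\<close> already places
    \<open>x\<close> in the interior of the hull.\<close>
  have S_U: "S \<subseteq> U"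
  proof
    fix x assume "x \<in> S"
    then obtain w where "lipschitz_path S x x w" "\<forall>t\<in>{0..1}. w t \<in> U"
      using interior_paths unfolding S_def U_def by blast
    then show "x \<in> U"
      by (force simp: lipschitz_path_def pathstart_def)
  qed
  \<comment> \<open>All three transforms are continuous on \<open>U\<close>, so the almost
    everywhere identity holds at every point of the support.\<close>
  have mid: "legendre Y gm x = (legendre Y g0 x + legendre Y g1 x) / 2" if "x \<in> S" for x
    using that S_U
    by (intro AE_eq_imp_eq_on_msupport[OF borel(1) AE_mid \<open>open U\<close>])
       (auto simp: S_def intro!: continuous_intros
         continuous_on_subset[OF continuous_on_legendre[OF \<open>Y \<noteq> {}\<close>]] dom_each[THEN subsetD])
  define k where "k = legendre Y g0 x0 - legendre Y g1 x0"
  have const: "legendre Y g0 x - legendre Y g1 x = k" if x: "x \<in> S" for x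
  proof -
    obtain w where w: "lipschitz_path S x0 x w"
      using interior_paths x0 x unfolding S_def by blast
    then obtain L where L: "L-lipschitz_on {0..1} w"
      by (auto simp: lipschitz_path_def)
    have img: "w ` {0..1} \<subseteq> S" and ends: "w 0 = x0" "w 1 = x"
      using w by (auto simp: lipschitz_path_def path_image_def pathstart_def pathfinish_def)
    have "legendre Y g0 (w 1) - legendre Y g1 (w 1) = legendre Y g0 (w 0) - legendre Y g1 (w 0)"
      using img S_U dom_each mid[unfolded gm_def]
      by (intro legendre_diff_constant_along_path[OF \<open>Y \<noteq> {}\<close> L]) blast+
    then show ?thesis
      by (simp add: ends k_def)
  qed
  \<comment> \<open>Almost everywhere each \<open>\<phi>\<close> equals the squared norm minus twice
    its transform, so a gap \<open>k\<close> between transforms is a gap \<open>- 2 * k\<close>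
    between potentials.\<close>
  define l where "l = - 2 * k"
  have fst_eq: "AE x in \<rho>. \<phi>0 x = \<phi>1 x + l"
    using AE_each(1,2) AE_in_msupport[OF borel(1)]
  proof eventually_elim
    case (elim x)
    then show ?case
      using const[of x] by (simp add: S_def quad_dual_def l_def field_simps)
  qed
  \<comment> \<open>Shifting the second pair by \<open>l\<close> makes the first components agree
    almost everywhere without affecting optimality.\<close>
  moreover have "AE y in \<mu>. \<psi>0 y = \<psi>1 y - l"
    using dual_optimal_snd_AE_eq[OF optimal(1) dual_optimal_shift[OF prob optimal(2)] fst_eq] .
  ultimately show ?thesis
    by blast
qed

end
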